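(* Let $(X,b,m)$ be a weighted graph satisfying (A). Then there exists an induced supergraph $(\widetilde X,\widetilde b,\widetilde m)$ of $(X,b,m)$ satisfying (A) such that $\widetilde L_c$, the restriction of the formal Laplacian of $(\widetilde X,\widetilde b,\widetilde m)$ to $C_c(\widetilde X)$, is essentially self-adjoint on $\ell^2(\widetilde X,\widetilde m)$.
   Context: A weighted graph $(X,b,m)$ consists of a countably infinite set $X$, a symmetric $b\colon X\times X\to[0,\infty)$ vanishing on the diagonal with $\sum_y b(x,y)<\infty$ for all $x$, and $m\colon X\to(0,\infty)$. Condition (A): $\sum_{y\in X}b^2(x,y)/m(y)<\infty$ for every $x\in X$. $(\widetilde X,\widetilde b,\widetilde m)$ is an induced supergraph of $(X,b,m)$ if it is a weighted graph with $X\subseteq\widetilde X$, $\widetilde b|_{X\times X}=b$ and $\widetilde m|_X=m$. All functions are real-valued; $\ell^2(X,m)$ has inner product $\langle f,g\rangle=\sum_x f(x)g(x)m(x)$. The formal Laplacian is $\Delta f(x)=\frac1{m(x)}\sum_y b(x,y)(f(x)-f(y))$ for $f$ with $\sum_y b(x,y)|f(y)|<\infty$ for all $x$. $C_c(X)$ is the set of finitely supported functions; under (A), the restriction of $\Delta$ to $C_c(X)$ is a symmetric positive operator on $\ell^2(X,m)$. An operator is essentially self-adjoint if it has a unique self-adjoint extension (equivalently, its closure is self-adjoint). *)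

theory Defs
  imports "HOL-Analysis.Analysis"
begin

locale weighted_graph =
  fixes X :: "'a set" and b :: "'a \<Rightarrow> 'a \<Rightarrow> real" and m :: "'a \<Rightarrow> real"
  assumes countable_X: "countable X"
    and infinite_X: "infinite X"
    and b_nonneg: "\<And>x y. x \<in> X \<Longrightarrow> y \<in> X \<Longrightarrow> 0 \<le> b x y"
    and b_sym: "\<And>x y. x \<in> X \<Longrightarrow> y \<in> X \<Longrightarrow> b x y = b y x"
    and b_diag: "\<And>x. x \<in> X \<Longrightarrow> b x x = 0"
    and b_summable: "\<And>x. x \<in> X \<Longrightarrow> (\<lambda>y. b x y) summable_on X"
    and m_pos: "\<And>x. x \<in> X \<Longrightarrow> 0 < m x"

definition condition_A :: "'a set \<Rightarrow> ('a \<Rightarrow> 'a \<Rightarrow> real) \<Rightarrow> ('a \<Rightarrow> real) \<Rightarrow> bool" where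
  "condition_A X b m \<longleftrightarrow> (\<forall>x\<in>X. (\<lambda>y. (b x y)\<^sup>2 / m y) summable_on X)"

definition induced_supergraph ::
  "'a set \<Rightarrow> ('a \<Rightarrow> 'a \<Rightarrow> real) \<Rightarrow> ('a \<Rightarrow> real) \<Rightarrow>
   'a set \<Rightarrow> ('a \<Rightarrow> 'a \<Rightarrow> real) \<Rightarrow> ('a \<Rightarrow> real) \<Rightarrow> bool" where
  "induced_supergraph X b m X' b' m' \<longleftrightarrow>
     weighted_graph X' b' m' \<and> X \<subseteq> X' \<and>
     (\<forall>x\<in>X. \<forall>y\<in>X. b' x y = b x y) \<and> (\<forall>x\<in>X. m' x = m x)"

text \<open>
  A function on \<open>X\<close> is represented by its extension by \<open>0\<close> to the whole type, so that
  functions which agree on \<open>X\<close> are equal.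
\<close>

definition l2 :: "'a set \<Rightarrow> ('a \<Rightarrow> real) \<Rightarrow> ('a \<Rightarrow> real) set" where
  "l2 X m = {f. (\<forall>x. x \<notin> X \<longrightarrow> f x = 0) \<and> (\<lambda>x. (f x)\<^sup>2 * m x) summable_on X}"

definition l2_inner :: "'a set \<Rightarrow> ('a \<Rightarrow> real) \<Rightarrow> ('a \<Rightarrow> real) \<Rightarrow> ('a \<Rightarrow> real) \<Rightarrow> real" where
  "l2_inner X m f g = (\<Sum>\<^sub>\<infinity>x\<in>X. f x * g x * m x)"

definition l2_norm :: "'a set \<Rightarrow> ('a \<Rightarrow> real) \<Rightarrow> ('a \<Rightarrow> real) \<Rightarrow> real" where
  "l2_norm X m f = sqrt (l2_inner X m f f)"

definition Cc :: "'a set \<Rightarrow> ('a \<Rightarrow> real) set" where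
  "Cc X = {f. (\<forall>x. x \<notin> X \<longrightarrow> f x = 0) \<and> finite {x. f x \<noteq> 0}}"

definition formal_domain :: "'a set \<Rightarrow> ('a \<Rightarrow> 'a \<Rightarrow> real) \<Rightarrow> ('a \<Rightarrow> real) set" where
  "formal_domain X b =
     {f. (\<forall>x. x \<notin> X \<longrightarrow> f x = 0) \<and> (\<forall>x\<in>X. (\<lambda>y. b x y * \<bar>f y\<bar>) summable_on X)}"

text \<open>Only meaningful for \<open>f\<close> in \<^const>\<open>formal_domain\<close>.\<close>

definition formal_laplacian ::
  "'a set \<Rightarrow> ('a \<Rightarrow> 'a \<Rightarrow> real) \<Rightarrow> ('a \<Rightarrow> real) \<Rightarrow> ('a \<Rightarrow> real) \<Rightarrow> 'a \<Rightarrow> real" where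
  "formal_laplacian X b m f x =
     (if x \<in> X then 1 / m x * (\<Sum>\<^sub>\<infinity>y\<in>X. b x y * (f x - f y)) else 0)"

lemma Cc_subset_formal_domain: "Cc X \<subseteq> formal_domain X b"
proof
  fix f assume f: "f \<in> Cc X"
  have "(\<lambda>y. b x y * \<bar>f y\<bar>) summable_on X" for x
  proof -
    have "(\<lambda>y. b x y * \<bar>f y\<bar>) summable_on {y. f y \<noteq> 0}"
      using f by (intro summable_on_finite) (auto simp: Cc_def)
    then show ?thesis
      using f by (subst summable_on_cong_neutral[where T = "{y. f y \<noteq> 0}"]) (auto simp: Cc_def)
  qed
  with f show "f \<in> formal_domain X b" by (auto simp: Cc_def formal_domain_def)
qed

text \<open>
  Unbounded operators on \<open>\<ell>\<^sup>2(X, m)\<close> are identified with their graphs: the pair \<open>(f, g)\<close> is in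
  \<open>T\<close> iff \<open>f\<close> is in the domain of the operator and is mapped to \<open>g\<close>.
  Then \<open>\<subseteq>\<close> is extension of operators.
\<close>

type_synonym 'a op_graph = "(('a \<Rightarrow> real) \<times> ('a \<Rightarrow> real)) set"

definition linear_operator :: "'a set \<Rightarrow> ('a \<Rightarrow> real) \<Rightarrow> 'a op_graph \<Rightarrow> bool" where
  "linear_operator X m T \<longleftrightarrow>
     T \<subseteq> l2 X m \<times> l2 X m \<and> single_valued T \<and>
     (\<lambda>_. 0, \<lambda>_. 0) \<in> T \<and>
     (\<forall>(f, g)\<in>T. \<forall>(f', g')\<in>T. (\<lambda>x. f x + f' x, \<lambda>x. g x + g' x) \<in> T) \<and>
     (\<forall>c. \<forall>(f, g)\<in>T. (\<lambda>x. c * f x, \<lambda>x. c * g x) \<in> T)"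

definition densely_defined :: "'a set \<Rightarrow> ('a \<Rightarrow> real) \<Rightarrow> 'a op_graph \<Rightarrow> bool" where
  "densely_defined X m T \<longleftrightarrow>
     (\<forall>f\<in>l2 X m. \<forall>e>0. \<exists>g\<in>Domain T. l2_norm X m (\<lambda>x. f x - g x) < e)"

text \<open>The graph of the adjoint \<open>T\<^sup>*\<close>; it is single-valued if \<open>T\<close> is densely defined.\<close>

definition adjoint_graph :: "'a set \<Rightarrow> ('a \<Rightarrow> real) \<Rightarrow> 'a op_graph \<Rightarrow> 'a op_graph" where
  "adjoint_graph X m T =
     {(g, h). g \<in> l2 X m \<and> h \<in> l2 X m \<and>
        (\<forall>(f, Tf)\<in>T. l2_inner X m Tf g = l2_inner X m f h)}"

definition self_adjoint :: "'a set \<Rightarrow> ('a \<Rightarrow> real) \<Rightarrow> 'a op_graph \<Rightarrow> bool" where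
  "self_adjoint X m T \<longleftrightarrow>
     linear_operator X m T \<and> densely_defined X m T \<and> adjoint_graph X m T = T"

definition essentially_self_adjoint :: "'a set \<Rightarrow> ('a \<Rightarrow> real) \<Rightarrow> 'a op_graph \<Rightarrow> bool" where
  "essentially_self_adjoint X m T \<longleftrightarrow>
     linear_operator X m T \<and> (\<exists>!S. self_adjoint X m S \<and> T \<subseteq> S)"

definition Lc :: "'a set \<Rightarrow> ('a \<Rightarrow> 'a \<Rightarrow> real) \<Rightarrow> ('a \<Rightarrow> real) \<Rightarrow> 'a op_graph" where
  "Lc X b m = {(f, formal_laplacian X b m f) | f. f \<in> Cc X}"

text \<open>
  A supergraph of a graph on \<open>X :: 'a set\<close> needs vertices outside \<open>X\<close>, of which the type \<open>'a\<close>
  may not have enough. The following functions carry the weights of a graph on \<open>X\<close> over to its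
  copy \<open>Inl ` X\<close> in \<open>'a + nat\<close>, whose complement is always infinite.
\<close>

definition copy_b :: "('a \<Rightarrow> 'a \<Rightarrow> real) \<Rightarrow> 'a + nat \<Rightarrow> 'a + nat \<Rightarrow> real" where
  "copy_b b u v = b (projl u) (projl v)"

definition copy_m :: "('a \<Rightarrow> real) \<Rightarrow> 'a + nat \<Rightarrow> real" where
  "copy_m m u = m (projl u)"

end

theory Submission
  imports Defs
begin

text \<open>
  If every \<open>u\<close> with \<open>u, \<Delta> u \<in> \<ell>\<^sup>2\<close> satisfies \<open>\<Sum>x. deg x * (u x)\<^sup>2 < \<infinity>\<close>, then all double sums in Green's
  formula converge absolutely, so the maximal operator is symmetric. It contains the adjoint of
  every extension of \<open>L\<^sub>c\<close>, hence it is the unique self-adjoint extension.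

  To enforce the hypothesis, attach to every vertex \<open>x\<close> a pendant vertex \<open>x'\<close> whose mass and edge
  weight are both \<open>\<beta> x = deg x + 1\<close>. Then \<open>\<Delta> u x' = u x' - u x\<close>, so \<open>u, \<Delta> u \<in> \<ell>\<^sup>2\<close> forces \<open>u x\<close>
  to be square summable with weight \<open>\<beta>\<close>, which controls the new degrees \<open>deg x + \<beta> x\<close> and \<open>\<beta> x\<close>.
\<close>

section \<open>Summability\<close>

text \<open>The factor 1/2 of the arithmetic-geometric mean inequality is given away, since the
  bound only serves as a majorant in summability proofs.\<close>

lemma abs_mult_le_sum_squares:
  fixes p q :: real
  shows "\<bar>p * q\<bar> \<le> p\<^sup>2 + q\<^sup>2"
proof -
  have "2 * (\<bar>p\<bar> * \<bar>q\<bar>) \<le> p\<^sup>2 + q\<^sup>2"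
    using sum_squares_bound[of "\<bar>p\<bar>" "\<bar>q\<bar>"] by simp
  moreover have "0 \<le> \<bar>p\<bar> * \<bar>q\<bar>" by simp
  ultimately show ?thesis unfolding abs_mult by linarith
qed

lemma infsum_diff_real:
  fixes f g :: "'a \<Rightarrow> real"
  assumes "f summable_on A" "g summable_on A"
  shows "(\<Sum>\<^sub>\<infinity>x\<in>A. f x - g x) = infsum f A - infsum g A"
  using infsum_add[OF assms(1) summable_on_uminus[THEN iffD2, OF assms(2)]]
  by (simp only: infsum_uminus diff_conv_add_uminus)

lemma summable_on_bounded_real:
  fixes f g :: "'a \<Rightarrow> real"
  assumes "g summable_on A" "\<And>x. x \<in> A \<Longrightarrow> \<bar>f x\<bar> \<le> g x"
  shows "f summable_on A"
  by (rule abs_summable_summable[OF Infinite_Sum.abs_summable_on_comparison_test'])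
    (use assms in auto)

lemma summable_on_Plus:
  fixes f :: "'a + 'b \<Rightarrow> real"
  assumes "(\<lambda>x. f (Inl x)) summable_on A" "(\<lambda>x. f (Inr x)) summable_on B"
  shows "f summable_on A <+> B"
  using assms unfolding Plus_def
  by (intro summable_on_Un_disjoint) (auto simp: summable_on_reindex o_def)

lemma infsum_Plus:
  fixes f :: "'a + 'b \<Rightarrow> real"
  assumes "(\<lambda>x. f (Inl x)) summable_on A" "(\<lambda>x. f (Inr x)) summable_on B"
  shows "infsum f (A <+> B) = (\<Sum>\<^sub>\<infinity>x\<in>A. f (Inl x)) + (\<Sum>\<^sub>\<infinity>x\<in>B. f (Inr x))"
  using assms unfolding Plus_def
  by (subst infsum_Un_disjoint) (auto simp: summable_on_reindex infsum_reindex o_def)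

lemma infsum_single:
  assumes "x \<in> A" "\<And>y. y \<in> A \<Longrightarrow> y \<noteq> x \<Longrightarrow> f y = 0"
  shows "infsum f A = f x"
  using assms by (subst infsum_cong_neutral[where T = "{x}" and g = f]) auto

lemma summable_on_single:
  assumes "\<And>y. y \<in> A \<Longrightarrow> y \<noteq> x \<Longrightarrow> f y = 0"
  shows "f summable_on A"
  by (rule finite_nonzero_values_imp_summable_on, rule finite_subset[of _ "{x}"])
    (use assms in auto)

section \<open>A criterion for essential self-adjointness\<close>

lemma adjoint_graph_antimono: "T \<subseteq> S \<Longrightarrow> adjoint_graph X m S \<subseteq> adjoint_graph X m T"
  unfolding adjoint_graph_def by blast

definition weighted_degree :: "'a set \<Rightarrow> ('a \<Rightarrow> 'a \<Rightarrow> real) \<Rightarrow> 'a \<Rightarrow> real" where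
  "weighted_degree X b x = (\<Sum>\<^sub>\<infinity>y\<in>X. b x y)"

lemma (in weighted_graph) weighted_degree_nonneg: "x \<in> X \<Longrightarrow> 0 \<le> weighted_degree X b x"
  unfolding weighted_degree_def by (intro infsum_nonneg b_nonneg)

text \<open>The domain does not mention \<open>formal_domain\<close>, yet under condition (A)
  \<open>l2_subset_formal_domain\<close> places every \<open>l2\<close> function in it, so the
  series in \<open>formal_laplacian\<close> converge.\<close>

definition maximal_laplacian ::
    "'a set \<Rightarrow> ('a \<Rightarrow> 'a \<Rightarrow> real) \<Rightarrow> ('a \<Rightarrow> real) \<Rightarrow> 'a op_graph" where
  "maximal_laplacian X b m =
     {(f, formal_laplacian X b m f) | f. f \<in> l2 X m \<and> formal_laplacian X b m f \<in> l2 X m}"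

locale weighted_graph_A = weighted_graph +
  assumes A: "condition_A X b m"
begin

section \<open>The space \<open>l2\<close> and the formal Laplacian on it under condition
  (A)\<close>

lemma l2_mult_summable:
  assumes "f \<in> l2 X m" "g \<in> l2 X m"
  shows "(\<lambda>x. f x * g x * m x) summable_on X"
proof (rule summable_on_bounded_real)
  show "(\<lambda>x. (f x)\<^sup>2 * m x + (g x)\<^sup>2 * m x) summable_on X"
    using assms by (intro summable_on_add) (auto simp: l2_def)
  fix x assume "x \<in> X"
  have "\<bar>f x * g x\<bar> * m x \<le> ((f x)\<^sup>2 + (g x)\<^sup>2) * m x"
    using m_pos[OF \<open>x \<in> X\<close>] by (intro mult_right_mono abs_mult_le_sum_squares) auto
  then show "\<bar>f x * g x * m x\<bar> \<le> (f x)\<^sup>2 * m x + (g x)\<^sup>2 * m x"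
    using m_pos[OF \<open>x \<in> X\<close>] by (simp add: abs_mult algebra_simps)
qed

lemma l2_zero: "(\<lambda>_. 0) \<in> l2 X m"
  by (simp add: l2_def)

lemma l2_add:
  assumes "f \<in> l2 X m" "g \<in> l2 X m"
  shows "(\<lambda>x. f x + g x) \<in> l2 X m"
proof -
  have "(\<lambda>x. ((f x)\<^sup>2 * m x + (g x)\<^sup>2 * m x) + 2 * (f x * g x * m x)) summable_on X"
    using assms by (intro summable_on_add summable_on_cmult_right l2_mult_summable)
      (auto simp: l2_def)
  then have "(\<lambda>x. (f x + g x)\<^sup>2 * m x) summable_on X"
    by (simp add: power2_eq_square algebra_simps)
  with assms show ?thesis by (auto simp: l2_def)
qed

lemma l2_scale:
  assumes "f \<in> l2 X m"
  shows "(\<lambda>x. c * f x) \<in> l2 X m"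
proof -
  have "(\<lambda>x. c\<^sup>2 * ((f x)\<^sup>2 * m x)) summable_on X"
    using assms by (intro summable_on_cmult_right) (auto simp: l2_def)
  with assms show ?thesis
    by (auto simp: l2_def power_mult_distrib algebra_simps)
qed

lemma l2_sum:
  assumes "\<And>i. i \<in> I \<Longrightarrow> f i \<in> l2 X m"
  shows "(\<lambda>x. \<Sum>i\<in>I. f i x) \<in> l2 X m"
  using assms by (induction I rule: infinite_finite_induct) (auto simp: l2_zero l2_add)

lemma Cc_subset_l2: "Cc X \<subseteq> l2 X m"
  by (auto simp: Cc_def l2_def elim!: rev_finite_subset intro!: finite_nonzero_values_imp_summable_on)

text \<open>Cauchy-Schwarz in disguise: b * |f| is the product of b / sqrt m, square summable by
  condition (A), and |f| * sqrt m, square summable since f is in \<open>l2\<close>.\<close>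

lemma l2_subset_formal_domain: "l2 X m \<subseteq> formal_domain X b"
proof
  fix f assume f: "f \<in> l2 X m"
  have "(\<lambda>y. b x y * \<bar>f y\<bar>) summable_on X" if x: "x \<in> X" for x
  proof (rule summable_on_bounded_real)
    show "(\<lambda>y. (b x y)\<^sup>2 / m y + (f y)\<^sup>2 * m y) summable_on X"
      using f A x by (intro summable_on_add) (auto simp: l2_def condition_A_def)
    fix y assume y: "y \<in> X"
    have m: "0 < m y" by (rule m_pos[OF y])
    have 0: "0 \<le> b x y * \<bar>f y\<bar>" using b_nonneg[OF x y] by simp
    \<comment> \<open>Completing this square yields 2 * b * |f| <= b^2 / m + f^2 * m directly,
      without square roots of m.\<close>
    have "0 \<le> (b x y - m y * \<bar>f y\<bar>)\<^sup>2 / m y" using m by simp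
    also have "\<dots> = (b x y)\<^sup>2 / m y + (f y)\<^sup>2 * m y - 2 * (b x y * \<bar>f y\<bar>)"
      using m by (simp add: power2_eq_square field_simps)
    finally show "\<bar>b x y * \<bar>f y\<bar>\<bar> \<le> (b x y)\<^sup>2 / m y + (f y)\<^sup>2 * m y"
      using 0 by linarith
  qed
  with f show "f \<in> formal_domain X b" by (auto simp: l2_def formal_domain_def)
qed

lemma formal_domain_summable:
  assumes "f \<in> formal_domain X b" "x \<in> X"
  shows "(\<lambda>y. b x y * f y) summable_on X"
  by (rule summable_on_bounded_real[of "\<lambda>y. b x y * \<bar>f y\<bar>"])
    (use assms b_nonneg in \<open>auto simp: formal_domain_def abs_mult\<close>)

lemma formal_laplacian_eq:
  assumes "f \<in> formal_domain X b" "x \<in> X"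
  shows "formal_laplacian X b m f x = (weighted_degree X b x * f x - (\<Sum>\<^sub>\<infinity>y\<in>X. b x y * f y)) / m x"
proof -
  have "(\<Sum>\<^sub>\<infinity>y\<in>X. b x y * (f x - f y)) = (\<Sum>\<^sub>\<infinity>y\<in>X. b x y * f x - b x y * f y)"
    by (simp add: algebra_simps)
  also have "\<dots> = (\<Sum>\<^sub>\<infinity>y\<in>X. b x y * f x) - (\<Sum>\<^sub>\<infinity>y\<in>X. b x y * f y)"
    using assms by (intro infsum_diff_real summable_on_cmult_left b_summable formal_domain_summable)
  also have "(\<Sum>\<^sub>\<infinity>y\<in>X. b x y * f x) = weighted_degree X b x * f x"
    unfolding weighted_degree_def by (rule infsum_cmult_left')
  finally show ?thesis using assms(2) by (simp add: formal_laplacian_def)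
qed

lemma formal_laplacian_add:
  assumes "f \<in> formal_domain X b" "g \<in> formal_domain X b"
  shows "formal_laplacian X b m (\<lambda>x. f x + g x) =
    (\<lambda>x. formal_laplacian X b m f x + formal_laplacian X b m g x)"
proof
  fix x
  show "formal_laplacian X b m (\<lambda>x. f x + g x) x =
      formal_laplacian X b m f x + formal_laplacian X b m g x"
  proof (cases "x \<in> X")
    case True
    have "(\<lambda>y. b x y * f x - b x y * f y) summable_on X"
         "(\<lambda>y. b x y * g x - b x y * g y) summable_on X"
      using assms True
        summable_on_add[OF _ summable_on_uminus[THEN iffD2], of "\<lambda>y. b x y * f x" X "\<lambda>y. b x y * f y"]
        summable_on_add[OF _ summable_on_uminus[THEN iffD2], of "\<lambda>y. b x y * g x" X "\<lambda>y. b x y * g y"]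
      by (simp_all add: summable_on_cmult_left b_summable formal_domain_summable)
    from infsum_add[OF this] show ?thesis
      using True by (simp add: formal_laplacian_def algebra_simps flip: distrib_left)
  qed (simp add: formal_laplacian_def)
qed

text \<open>Holds for arbitrary f: \<open>infsum\<close> is 0 on a divergent series and a nonzero
  constant does not affect convergence, so constants always factor out.\<close>

lemma formal_laplacian_scale:
  "formal_laplacian X b m (\<lambda>x. c * f x) = (\<lambda>x. c * formal_laplacian X b m f x)"
proof
  fix x
  have "(\<Sum>\<^sub>\<infinity>y\<in>X. b x y * (c * f x - c * f y)) = (\<Sum>\<^sub>\<infinity>y\<in>X. c * (b x y * (f x - f y)))"
    by (simp add: algebra_simps)
  also have "\<dots> = c * (\<Sum>\<^sub>\<infinity>y\<in>X. b x y * (f x - f y))"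
    by (rule infsum_cmult_right')
  finally show "formal_laplacian X b m (\<lambda>x. c * f x) x = c * formal_laplacian X b m f x"
    by (simp add: formal_laplacian_def)
qed

text \<open>The Laplacian of f is a finitely supported diagonal part \<open>d\<close> minus a finite
  combination of the columns \<open>k y\<close>. By symmetry of b, the squared norm of
  \<open>k y\<close> is exactly the series that condition (A) makes finite at y.\<close>

lemma formal_laplacian_Cc_in_l2:
  assumes f: "f \<in> Cc X"
  shows "formal_laplacian X b m f \<in> l2 X m"
proof -
  define F where "F = {y. f y \<noteq> 0}"
  have F: "finite F" "F \<subseteq> X" using f by (auto simp: F_def Cc_def)
  define k where "k y x = (if x \<in> X then b x y / m x else 0)" for x y
  have k: "k y \<in> l2 X m" if y: "y \<in> X" for y
  proof -
    have "(\<lambda>x. (b y x)\<^sup>2 / m x) summable_on X"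
      using A y by (auto simp: condition_A_def)
    then have "(\<lambda>x. (k y x)\<^sup>2 * m x) summable_on X"
    proof (rule summable_on_cong[THEN iffD1, rotated])
      fix x assume "x \<in> X"
      then show "(b y x)\<^sup>2 / m x = (k y x)\<^sup>2 * m x"
        using m_pos[of x] b_sym[of x y] y by (simp add: k_def field_simps power2_eq_square)
    qed
    then show ?thesis by (auto simp: l2_def k_def)
  qed
  define d where "d x = weighted_degree X b x / m x * f x" for x
  have d: "d \<in> Cc X" using f by (auto simp: Cc_def d_def elim: rev_finite_subset)
  have "formal_laplacian X b m f = (\<lambda>x. d x + (-1) * (\<Sum>y\<in>F. f y * k y x))"
  proof
    fix x
    show "formal_laplacian X b m f x = d x + (-1) * (\<Sum>y\<in>F. f y * k y x)"
    proof (cases "x \<in> X")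
      case True
      have "(\<Sum>\<^sub>\<infinity>y\<in>X. b x y * f y) = (\<Sum>y\<in>F. b x y * f y)"
        using F by (subst infsum_cong_neutral[where T = F and g = "\<lambda>y. b x y * f y"])
          (auto simp: F_def)
      then show ?thesis
        using True f Cc_subset_formal_domain[of X b]
        by (subst formal_laplacian_eq)
          (auto simp: d_def k_def sum_divide_distrib diff_divide_distrib mult.commute)
    next
      case False
      with d show ?thesis by (auto simp: formal_laplacian_def k_def Cc_def)
    qed
  qed
  also have "\<dots> \<in> l2 X m"
    using d Cc_subset_l2 F k by (intro l2_add l2_scale l2_sum) auto
  finally show ?thesis .
qed

section \<open>The minimal and the maximal Laplacian as operators on \<open>l2\<close>\<close>

lemma linear_operator_laplacian_restriction:
  assumes D: "D \<subseteq> l2 X m" "\<And>f. f \<in> D \<Longrightarrow> formal_laplacian X b m f \<in> l2 X m" "(\<lambda>_. 0) \<in> D"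
    "\<And>f g. f \<in> D \<Longrightarrow> g \<in> D \<Longrightarrow> (\<lambda>x. f x + g x) \<in> D" "\<And>c f. f \<in> D \<Longrightarrow> (\<lambda>x. c * f x) \<in> D"
  shows "linear_operator X m {(f, formal_laplacian X b m f) | f. f \<in> D}"
proof -
  have 0: "formal_laplacian X b m (\<lambda>_. 0) = (\<lambda>_. 0)"
    by (auto simp: formal_laplacian_def)
  have "f \<in> formal_domain X b" if "f \<in> D" for f
    using that D(1) l2_subset_formal_domain by blast
  then show ?thesis
    using D unfolding linear_operator_def
    by (auto simp: single_valued_def 0 formal_laplacian_add formal_laplacian_scale)
qed

lemma linear_operator_Lc: "linear_operator X m (Lc X b m)"
  unfolding Lc_def
proof (rule linear_operator_laplacian_restriction)
  show "(\<lambda>x. f x + g x) \<in> Cc X" if "f \<in> Cc X" "g \<in> Cc X" for f g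
  proof -
    have "finite ({x. f x \<noteq> 0} \<union> {x. g x \<noteq> 0})" using that by (auto simp: Cc_def)
    then have "finite {x. f x + g x \<noteq> 0}" by (rule rev_finite_subset) auto
    with that show ?thesis by (auto simp: Cc_def)
  qed
  show "(\<lambda>x. c * f x) \<in> Cc X" if "f \<in> Cc X" for c f
    using that by (auto simp: Cc_def)
qed (use Cc_subset_l2 formal_laplacian_Cc_in_l2 in \<open>auto simp: Cc_def\<close>)

lemma linear_operator_maximal_laplacian: "linear_operator X m (maximal_laplacian X b m)"
proof -
  have "linear_operator X m {(f, formal_laplacian X b m f) | f.
      f \<in> {f \<in> l2 X m. formal_laplacian X b m f \<in> l2 X m}}"
  proof (rule linear_operator_laplacian_restriction)
    have "formal_laplacian X b m (\<lambda>_. 0) = (\<lambda>_. 0)"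
      by (auto simp: formal_laplacian_def)
    then show "(\<lambda>_. 0) \<in> {f \<in> l2 X m. formal_laplacian X b m f \<in> l2 X m}"
      by (simp add: l2_zero)
    show "(\<lambda>x. f x + g x) \<in> {f \<in> l2 X m. formal_laplacian X b m f \<in> l2 X m}"
      if "f \<in> {f \<in> l2 X m. formal_laplacian X b m f \<in> l2 X m}"
        "g \<in> {f \<in> l2 X m. formal_laplacian X b m f \<in> l2 X m}" for f g
    proof -
      have "f \<in> formal_domain X b" "g \<in> formal_domain X b"
        using that l2_subset_formal_domain by auto
      with that show ?thesis by (simp add: formal_laplacian_add l2_add)
    qed
    show "(\<lambda>x. c * f x) \<in> {f \<in> l2 X m. formal_laplacian X b m f \<in> l2 X m}"
      if "f \<in> {f \<in> l2 X m. formal_laplacian X b m f \<in> l2 X m}" for c f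
      unfolding mem_Collect_eq formal_laplacian_scale using that by (simp add: l2_scale)
  qed auto
  then show ?thesis by (simp add: maximal_laplacian_def)
qed

lemma Lc_subset_maximal_laplacian: "Lc X b m \<subseteq> maximal_laplacian X b m"
  using Cc_subset_l2 formal_laplacian_Cc_in_l2 by (auto simp: Lc_def maximal_laplacian_def)

lemma densely_defined_Lc: "densely_defined X m (Lc X b m)"
  unfolding densely_defined_def
proof (intro ballI allI impI)
  fix f :: "'a \<Rightarrow> real" and e :: real
  assume f: "f \<in> l2 X m" and e: "e > 0"
  let ?h = "\<lambda>x. (f x)\<^sup>2 * m x"
  have h: "?h summable_on X" using f by (auto simp: l2_def)
  \<comment> \<open>The squared distance from f to its truncation is the tail of this series. The
    approximation is only non-strict, so half of e^2 is requested to end strictly below e^2.\<close>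
  from infsum_finite_approximation[OF h, of "e\<^sup>2 / 2"] e
  obtain F where F: "finite F" "F \<subseteq> X" "dist (sum ?h F) (infsum ?h X) \<le> e\<^sup>2 / 2" by auto
  define g where "g x = (if x \<in> F then f x else 0)" for x
  have "g \<in> Cc X"
    using F by (auto simp: Cc_def g_def intro: finite_subset[of _ F])
  then have "g \<in> Domain (Lc X b m)" by (auto simp: Lc_def)
  moreover have "l2_norm X m (\<lambda>x. f x - g x) < e"
  proof -
    have "l2_inner X m (\<lambda>x. f x - g x) (\<lambda>x. f x - g x)
        = (\<Sum>\<^sub>\<infinity>x\<in>X. ?h x - (if x \<in> F then ?h x else 0))"
      unfolding l2_inner_def by (intro infsum_cong) (auto simp: g_def power2_eq_square)
    also have "\<dots> = infsum ?h X - (\<Sum>\<^sub>\<infinity>x\<in>X. if x \<in> F then ?h x else 0)"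
      using F by (intro infsum_diff_real h finite_nonzero_values_imp_summable_on)
        (auto intro: finite_subset[of _ F])
    also have "(\<Sum>\<^sub>\<infinity>x\<in>X. if x \<in> F then ?h x else 0) = sum ?h F"
      using F by (subst infsum_cong_neutral[where T = F and g = ?h]) auto
    also have "infsum ?h X - sum ?h F \<le> e\<^sup>2 / 2"
      using F(3) unfolding dist_real_def by linarith
    also have "\<dots> < e\<^sup>2" using e by simp
    finally show ?thesis
      unfolding l2_norm_def using e by (intro real_less_lsqrt) auto
  qed
  ultimately show "\<exists>g\<in>Domain (Lc X b m). l2_norm X m (\<lambda>x. f x - g x) < e" by blast
qed

text \<open>Testing the adjoint relation against the indicator of a single vertex x determines h at
  x, and symmetry of b identifies that value with the Laplacian of g at x.\<close>

lemma adjoint_Lc_subset_maximal_laplacian: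
  "adjoint_graph X m (Lc X b m) \<subseteq> maximal_laplacian X b m"
proof clarify
  fix g h assume gh: "(g, h) \<in> adjoint_graph X m (Lc X b m)"
  then have l2: "g \<in> l2 X m" "h \<in> l2 X m" by (auto simp: adjoint_graph_def)
  then have dom: "g \<in> formal_domain X b" using l2_subset_formal_domain by blast
  have "h x = formal_laplacian X b m g x" for x
  proof (cases "x \<in> X")
    case True
    define d where "d = (\<lambda>y. if y = x then 1 else 0 :: real)"
    have d: "d \<in> Cc X" using True by (auto simp: d_def Cc_def)
    have "l2_inner X m (formal_laplacian X b m d) g = l2_inner X m d h"
      using gh d by (auto simp: adjoint_graph_def Lc_def)
    moreover have "l2_inner X m d h = h x * m x"
      unfolding l2_inner_def using True by (subst infsum_single[of x]) (auto simp: d_def)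
    moreover have "l2_inner X m (formal_laplacian X b m d) g =
        (\<Sum>\<^sub>\<infinity>y\<in>X. weighted_degree X b y * d y * g y - b x y * g y)"
      unfolding l2_inner_def
    proof (rule infsum_cong)
      fix y assume y: "y \<in> X"
      have "formal_laplacian X b m d y = (weighted_degree X b y * d y - b y x) / m y"
        using d y Cc_subset_formal_domain[of X b] True
        by (subst formal_laplacian_eq) (auto simp: infsum_single[of x] d_def)
      then show "formal_laplacian X b m d y * g y * m y = weighted_degree X b y * d y * g y - b x y * g y"
        using m_pos[OF y] b_sym[OF y True] by (simp add: left_diff_distrib diff_divide_distrib)
    qed
    moreover have "\<dots> = (\<Sum>\<^sub>\<infinity>y\<in>X. weighted_degree X b y * d y * g y) - (\<Sum>\<^sub>\<infinity>y\<in>X. b x y * g y)"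
      using dom True
      by (intro infsum_diff_real formal_domain_summable summable_on_single[of _ x])
        (auto simp: d_def)
    moreover have "(\<Sum>\<^sub>\<infinity>y\<in>X. weighted_degree X b y * d y * g y) = weighted_degree X b x * g x"
      using True by (subst infsum_single[of x]) (auto simp: d_def)
    ultimately have "h x * m x = weighted_degree X b x * g x - (\<Sum>\<^sub>\<infinity>y\<in>X. b x y * g y)" by simp
    then show ?thesis
      using m_pos[OF True] by (simp add: formal_laplacian_eq[OF dom True] eq_divide_eq)
  next
    case False
    then show ?thesis using l2 by (auto simp: l2_def formal_laplacian_def)
  qed
  then have "h = formal_laplacian X b m g" by blast
  with l2 show "(g, h) \<in> maximal_laplacian X b m" by (auto simp: maximal_laplacian_def)
qed

section \<open>Green's formula for functions square summable against the degree\<close>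

lemma b_square_summable:
  assumes "(\<lambda>x. weighted_degree X b x * (u x)\<^sup>2) summable_on X"
  shows "(\<lambda>(x, y). b x y * (u x)\<^sup>2) summable_on X \<times> X"
proof (rule summable_on_SigmaI)
  \<comment> \<open>Tonelli for nonnegative terms: row x sums to the degree of x times u(x)^2, and
    these row sums are summable by assumption.\<close>
  show "((\<lambda>y. (case (x, y) of (x, y) \<Rightarrow> b x y * (u x)\<^sup>2)) has_sum weighted_degree X b x * (u x)\<^sup>2) X"
    if "x \<in> X" for x
    using has_sum_cmult_left[OF has_sum_infsum[OF b_summable[OF that]], of "(u x)\<^sup>2"]
    by (simp add: weighted_degree_def)
qed (use assms b_nonneg in auto)

text \<open>The majorant is b(x,y) * u(y)^2 + b(x,y) * v(x)^2. The second part is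
  \<open>b_square_summable\<close>; the first reduces to it by exchanging the coordinates and using
  symmetry of b.\<close>

lemma b_mult_summable:
  assumes u: "(\<lambda>x. weighted_degree X b x * (u x)\<^sup>2) summable_on X"
    and v: "(\<lambda>x. weighted_degree X b x * (v x)\<^sup>2) summable_on X"
  shows "(\<lambda>(x, y). b x y * u y * v x) summable_on X \<times> X"
proof -
  have swapped: "(\<lambda>(x, y). b x y * (u y)\<^sup>2) summable_on X \<times> X"
    using summable_on_swap[THEN iffD1, OF b_square_summable[OF u]]
    by (rule summable_on_cong[THEN iffD1, rotated]) (auto simp: b_sym)
  show ?thesis
    by (rule summable_on_bounded_real[OF summable_on_add[OF swapped b_square_summable[OF v]]])
      (use b_nonneg mult_left_mono[OF abs_mult_le_sum_squares] in
        \<open>auto simp: abs_mult distrib_left mult.assoc\<close>)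
qed

text \<open>The degree hypotheses make both terms on the right converge separately. The first is
  visibly symmetric in u and v, so symmetry of the Laplacian is reduced to an interchange of the
  double sum.\<close>

lemma green_formula:
  assumes dom: "u \<in> formal_domain X b" "v \<in> formal_domain X b"
    and u: "(\<lambda>x. weighted_degree X b x * (u x)\<^sup>2) summable_on X"
    and v: "(\<lambda>x. weighted_degree X b x * (v x)\<^sup>2) summable_on X"
  shows "l2_inner X m (formal_laplacian X b m u) v =
    (\<Sum>\<^sub>\<infinity>x\<in>X. weighted_degree X b x * u x * v x) - (\<Sum>\<^sub>\<infinity>x\<in>X. \<Sum>\<^sub>\<infinity>y\<in>X. b x y * u y * v x)"
proof -
  have uv: "(\<lambda>x. weighted_degree X b x * u x * v x) summable_on X"
  proof (rule summable_on_bounded_real[OF summable_on_add[OF u v]])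
    fix x assume "x \<in> X"
    then have "0 \<le> weighted_degree X b x" by (rule weighted_degree_nonneg)
    then show "\<bar>weighted_degree X b x * u x * v x\<bar> \<le> weighted_degree X b x * (u x)\<^sup>2 + weighted_degree X b x * (v x)\<^sup>2"
      using mult_left_mono[OF abs_mult_le_sum_squares[of "u x" "v x"]]
      by (simp add: abs_mult distrib_left mult.assoc)
  qed
  have "(\<lambda>(x, y). b x y * u y * v x) summable_on X \<times> X"
    by (rule b_mult_summable[OF u v])
  then have b: "(\<lambda>x. \<Sum>\<^sub>\<infinity>y\<in>X. b x y * u y * v x) summable_on X"
    by (rule summable_on_Sigma_banach)
  have "l2_inner X m (formal_laplacian X b m u) v =
      (\<Sum>\<^sub>\<infinity>x\<in>X. weighted_degree X b x * u x * v x - (\<Sum>\<^sub>\<infinity>y\<in>X. b x y * u y * v x))"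
    unfolding l2_inner_def
  proof (rule infsum_cong)
    fix x assume x: "x \<in> X"
    have "(\<Sum>\<^sub>\<infinity>y\<in>X. b x y * u y * v x) = (\<Sum>\<^sub>\<infinity>y\<in>X. b x y * u y) * v x"
      by (rule infsum_cmult_left')
    then show "formal_laplacian X b m u x * v x * m x =
        weighted_degree X b x * u x * v x - (\<Sum>\<^sub>\<infinity>y\<in>X. b x y * u y * v x)"
      using m_pos[OF x] by (simp add: formal_laplacian_eq[OF dom(1) x] field_simps)
  qed
  also have "\<dots> = (\<Sum>\<^sub>\<infinity>x\<in>X. weighted_degree X b x * u x * v x) -
      (\<Sum>\<^sub>\<infinity>x\<in>X. \<Sum>\<^sub>\<infinity>y\<in>X. b x y * u y * v x)"
    by (rule infsum_diff_real[OF uv b])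
  finally show ?thesis .
qed

theorem essentially_self_adjoint_criterion:
  assumes "\<And>u. u \<in> l2 X m \<Longrightarrow> formal_laplacian X b m u \<in> l2 X m \<Longrightarrow>
    (\<lambda>x. weighted_degree X b x * (u x)\<^sup>2) summable_on X"
  shows "essentially_self_adjoint X m (Lc X b m)"
proof -
  define S where "S = maximal_laplacian X b m"
  have T: "Lc X b m \<subseteq> S" unfolding S_def by (rule Lc_subset_maximal_laplacian)
  \<comment> \<open>Adjoints shrink as operators grow, and the adjoint of \<open>Lc\<close> already
    lies in \<open>S\<close>. This serves both for \<open>S\<close> itself and for any competing
    self-adjoint extension.\<close>
  have adj: "adjoint_graph X m S' \<subseteq> S" if "Lc X b m \<subseteq> S'" for S'
    using adjoint_graph_antimono[OF that] adjoint_Lc_subset_maximal_laplacian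
    unfolding S_def by blast
  have "S \<subseteq> adjoint_graph X m S"
  proof -
    have "l2_inner X m (formal_laplacian X b m u) v = l2_inner X m u (formal_laplacian X b m v)"
      if uv: "u \<in> l2 X m" "formal_laplacian X b m u \<in> l2 X m"
        "v \<in> l2 X m" "formal_laplacian X b m v \<in> l2 X m" for u v
    proof -
      have dom: "u \<in> formal_domain X b" "v \<in> formal_domain X b"
        using uv l2_subset_formal_domain by auto
      \<comment> \<open>Summability over the product \<open>X \<times> X\<close> from
        \<open>b_mult_summable\<close> permits the interchange; symmetry of b then returns the same
        expression with u and v exchanged.\<close>
      have "(\<Sum>\<^sub>\<infinity>x\<in>X. \<Sum>\<^sub>\<infinity>y\<in>X. b x y * u y * v x) = (\<Sum>\<^sub>\<infinity>x\<in>X. \<Sum>\<^sub>\<infinity>y\<in>X. b y x * u x * v y)"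
        by (rule infsum_swap_banach) (intro b_mult_summable assms uv)
      also have "\<dots> = (\<Sum>\<^sub>\<infinity>x\<in>X. \<Sum>\<^sub>\<infinity>y\<in>X. b x y * v y * u x)"
        by (intro infsum_cong) (simp add: b_sym mult_ac)
      finally have "l2_inner X m (formal_laplacian X b m u) v =
          l2_inner X m (formal_laplacian X b m v) u"
        using green_formula[OF dom] green_formula[OF dom(2,1)] assms uv by (simp add: mult_ac)
      then show ?thesis by (simp add: l2_inner_def mult_ac)
    qed
    then show ?thesis
      unfolding S_def maximal_laplacian_def adjoint_graph_def by auto
  qed
  with adj[OF T] have S_adj: "adjoint_graph X m S = S" by blast
  have "densely_defined X m S"
    using densely_defined_Lc T unfolding densely_defined_def by (meson Domain_mono subsetD)
  then have "self_adjoint X m S"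
    using S_adj linear_operator_maximal_laplacian unfolding self_adjoint_def S_def by blast
  moreover have "S' = S" if S': "self_adjoint X m S'" "Lc X b m \<subseteq> S'" for S'
  proof -
    have eq: "adjoint_graph X m S' = S'" using S' by (simp add: self_adjoint_def)
    with adj[OF S'(2)] have sub: "S' \<subseteq> S" by simp
    \<comment> \<open>A self-adjoint operator has no proper self-adjoint extension: taking adjoints
      reverses the inclusion \<open>sub\<close> while fixing both sides.\<close>
    with adjoint_graph_antimono[OF sub, of X m] eq S_adj show ?thesis by blast
  qed
  ultimately show ?thesis
    using linear_operator_Lc T unfolding essentially_self_adjoint_def by blast
qed

end

section \<open>Attaching pendant vertices\<close>

text \<open>\<open>Inr n\<close> is the pendant vertex attached to the \<open>n\<close>-th element of \<open>X\<close>.\<close>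

definition pendant_weight :: "'a set \<Rightarrow> ('a \<Rightarrow> 'a \<Rightarrow> real) \<Rightarrow> nat \<Rightarrow> real" where
  "pendant_weight X b n = weighted_degree X b (from_nat_into X n) + 1"

definition pendant_b ::
    "'a set \<Rightarrow> ('a \<Rightarrow> 'a \<Rightarrow> real) \<Rightarrow> 'a + nat \<Rightarrow> 'a + nat \<Rightarrow> real" where
  "pendant_b X b u v =
    (case (u, v) of
      (Inl x, Inl y) \<Rightarrow> b x y
    | (Inl x, Inr n) \<Rightarrow> if x = from_nat_into X n then pendant_weight X b n else 0
    | (Inr n, Inl x) \<Rightarrow> if x = from_nat_into X n then pendant_weight X b n else 0
    | (Inr _, Inr _) \<Rightarrow> 0)"

definition pendant_m ::
    "'a set \<Rightarrow> ('a \<Rightarrow> 'a \<Rightarrow> real) \<Rightarrow> ('a \<Rightarrow> real) \<Rightarrow> 'a + nat \<Rightarrow> real" where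
  "pendant_m X b m u = (case u of Inl x \<Rightarrow> m x | Inr n \<Rightarrow> pendant_weight X b n)"

lemma pendant_b_simps [simp]:
  "pendant_b X b (Inl x) (Inl y) = b x y"
  "pendant_b X b (Inl x) (Inr n) = (if x = from_nat_into X n then pendant_weight X b n else 0)"
  "pendant_b X b (Inr n) (Inl x) = (if x = from_nat_into X n then pendant_weight X b n else 0)"
  "pendant_b X b (Inr n) (Inr k) = 0"
  by (simp_all add: pendant_b_def)

lemma pendant_m_simps [simp]:
  "pendant_m X b m (Inl x) = m x"
  "pendant_m X b m (Inr n) = pendant_weight X b n"
  by (simp_all add: pendant_m_def)

section \<open>The pendant graph as a weighted graph with condition (A)\<close>

context weighted_graph
begin

text \<open>Infinity of X makes the enumeration injective, so every vertex receives exactly one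
  leaf.\<close>

lemma bij_from_nat_into: "bij_betw (from_nat_into X) UNIV X"
  by (rule bij_betw_from_nat_into[OF countable_X infinite_X])

lemma from_nat_into_mem: "from_nat_into X n \<in> X"
  using infinite_X by (intro from_nat_into) auto

lemma from_nat_into_inj: "from_nat_into X n = from_nat_into X k \<longleftrightarrow> n = k"
  using bij_from_nat_into by (auto simp: bij_betw_def inj_on_def)

lemma from_nat_into_cases:
  assumes "x \<in> X"
  obtains n where "x = from_nat_into X n"
  using assms bij_from_nat_into by (auto simp: bij_betw_def)

text \<open>The summand 1 in \<open>pendant_weight\<close> keeps the leaf's mass positive even when
  its vertex has degree 0.\<close>

lemma pendant_weight_pos: "0 < pendant_weight X b n"
  using weighted_degree_nonneg[OF from_nat_into_mem[of n]] by (simp add: pendant_weight_def)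

lemma summable_pendant_neighbour:
  assumes "x \<in> X" "\<And>n. x \<noteq> from_nat_into X n \<Longrightarrow> f n = (0 :: real)"
  shows "f summable_on (UNIV :: nat set)"
proof -
  obtain k where "x = from_nat_into X k" using from_nat_into_cases[OF assms(1)] .
  with assms(2) show ?thesis by (intro summable_on_single[of _ k]) (simp add: from_nat_into_inj)
qed

lemma weighted_graph_pendant: "weighted_graph (X <+> UNIV) (pendant_b X b) (pendant_m X b m)"
proof
  show "countable (X <+> (UNIV :: nat set))" using countable_X by simp
  show "infinite (X <+> (UNIV :: nat set))" by (simp add: finite_Plus_iff)
next
  fix u v assume "u \<in> X <+> (UNIV :: nat set)" "v \<in> X <+> (UNIV :: nat set)"
  then show "0 \<le> pendant_b X b u v" "pendant_b X b u v = pendant_b X b v u"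
    using pendant_weight_pos by (auto simp: b_nonneg b_sym less_imp_le)
next
  fix u assume u: "u \<in> X <+> (UNIV :: nat set)"
  then show "pendant_b X b u u = 0" "0 < pendant_m X b m u"
    using pendant_weight_pos by (auto simp: b_diag m_pos)
  from u show "pendant_b X b u summable_on X <+> UNIV"
  proof (elim PlusE)
    fix x assume x: "x \<in> X" "u = Inl x"
    then show ?thesis
      by (auto intro!: summable_on_Plus b_summable summable_pendant_neighbour[of x])
  next
    fix n assume "u = Inr n"
    then show ?thesis
      by (auto intro!: summable_on_Plus summable_on_single[of _ "from_nat_into X n"])
  qed
qed

text \<open>The row of an old vertex gains a single nonzero term, from its leaf, and the row of a
  leaf has only one nonzero entry.\<close>

lemma condition_A_pendant:
  assumes "condition_A X b m"
  shows "condition_A (X <+> UNIV) (pendant_b X b) (pendant_m X b m)"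
  unfolding condition_A_def
proof
  fix u assume "u \<in> X <+> (UNIV :: nat set)"
  then show "(\<lambda>v. (pendant_b X b u v)\<^sup>2 / pendant_m X b m v) summable_on X <+> UNIV"
  proof (elim PlusE)
    fix x assume x: "x \<in> X" "u = Inl x"
    then show ?thesis
      using assms
      by (intro summable_on_Plus) (auto simp: condition_A_def intro!: summable_pendant_neighbour[of x])
  next
    fix n assume "u = Inr n"
    then show ?thesis
      by (intro summable_on_Plus) (auto intro!: summable_on_single[of _ "from_nat_into X n"])
  qed
qed

lemma induced_supergraph_pendant:
  "induced_supergraph (Inl ` X) (copy_b b) (copy_m m)
    (X <+> UNIV) (pendant_b X b) (pendant_m X b m)"
  using weighted_graph_pendant by (auto simp: induced_supergraph_def copy_b_def copy_m_def)

section \<open>Degrees and the Laplacian on the pendant graph\<close>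

lemma weighted_degree_pendant:
  "weighted_degree (X <+> UNIV) (pendant_b X b) (Inl (from_nat_into X n)) =
    weighted_degree X b (from_nat_into X n) + pendant_weight X b n" (is ?base)
  "weighted_degree (X <+> UNIV) (pendant_b X b) (Inr n) = pendant_weight X b n" (is ?leaf)
proof -
  let ?x = "from_nat_into X n"
  have x: "?x \<in> X" by (rule from_nat_into_mem)
  show ?base
    unfolding weighted_degree_def using x b_summable[OF x]
    by (subst infsum_Plus)
      (auto simp: infsum_single[of n] from_nat_into_inj intro!: summable_pendant_neighbour[OF x])
  show ?leaf
    unfolding weighted_degree_def using x
    by (subst infsum_Plus) (auto simp: infsum_single[of ?x] intro!: summable_on_single[of _ ?x])
qed

text \<open>A leaf has one neighbour, so the series has at most one nonzero term for any u; the edge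
  weight then cancels against the equal mass.\<close>

lemma formal_laplacian_pendant:
  "formal_laplacian (X <+> UNIV) (pendant_b X b) (pendant_m X b m) u (Inr n) =
    u (Inr n) - u (Inl (from_nat_into X n))"
proof -
  let ?x = "from_nat_into X n"
  have x: "?x \<in> X" by (rule from_nat_into_mem)
  have "(\<Sum>\<^sub>\<infinity>v\<in>X <+> UNIV. pendant_b X b (Inr n) v * (u (Inr n) - u v)) =
      pendant_weight X b n * (u (Inr n) - u (Inl ?x))"
    using x by (subst infsum_Plus)
      (auto simp: infsum_single[of ?x] intro!: summable_on_single[of _ ?x])
  then show ?thesis
    using pendant_weight_pos[of n] by (simp add: formal_laplacian_def InrI)
qed

lemma pendant_degree_summable:
  assumes A: "condition_A X b m"
    and u: "u \<in> l2 (X <+> UNIV) (pendant_m X b m)"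
    and Lu: "formal_laplacian (X <+> UNIV) (pendant_b X b) (pendant_m X b m) u
      \<in> l2 (X <+> UNIV) (pendant_m X b m)" (is "?L \<in> _")
  shows "(\<lambda>v. weighted_degree (X <+> UNIV) (pendant_b X b) v * (u v)\<^sup>2) summable_on X <+> UNIV"
proof (rule summable_on_Plus)
  interpret P: weighted_graph_A "X <+> UNIV" "pendant_b X b" "pendant_m X b m"
    using weighted_graph_pendant condition_A_pendant[OF A]
    by (simp add: weighted_graph_A_def weighted_graph_A_axioms_def)
  let ?w = "pendant_weight X b"
  \<comment> \<open>Stated for general f because it is applied twice: to u, and to u minus its
    Laplacian.\<close>
  have Inr: "(\<lambda>n. (f (Inr n))\<^sup>2 * ?w n) summable_on UNIV"
    if "f \<in> l2 (X <+> UNIV) (pendant_m X b m)" for f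
  proof -
    have "(\<lambda>v. (f v)\<^sup>2 * pendant_m X b m v) summable_on Inr ` UNIV"
      by (rule summable_on_subset_banach[of _ "X <+> UNIV"]) (use that in \<open>auto simp: l2_def\<close>)
    then show ?thesis by (simp add: summable_on_reindex o_def)
  qed
  from Inr[OF u]
  show "(\<lambda>n. weighted_degree (X <+> UNIV) (pendant_b X b) (Inr n) * (u (Inr n))\<^sup>2)
      summable_on UNIV"
    by (simp add: weighted_degree_pendant mult.commute)
  \<comment> \<open>At the n-th leaf this \<open>l2\<close> function takes the value of u at the
    n-th vertex of X, so the leaf's mass becomes a weight on that value.\<close>
  have "(\<lambda>v. u v + (-1) * ?L v) \<in> l2 (X <+> UNIV) (pendant_m X b m)"
    by (intro P.l2_add P.l2_scale u Lu)
  from Inr[OF this] have "(\<lambda>n. (u (Inl (from_nat_into X n)))\<^sup>2 * ?w n) summable_on UNIV"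
    by (simp add: formal_laplacian_pendant)
  \<comment> \<open>The factor 2 absorbs the enlarged degree: the old degree is at most
    \<open>?w n\<close>, so old degree plus \<open>?w n\<close> is at most twice
    \<open>?w n\<close>.\<close>
  then have "(\<lambda>n. 2 * ((u (Inl (from_nat_into X n)))\<^sup>2 * ?w n)) summable_on UNIV"
    by (rule summable_on_cmult_right)
  then have "(\<lambda>n. weighted_degree (X <+> UNIV) (pendant_b X b) (Inl (from_nat_into X n)) *
      (u (Inl (from_nat_into X n)))\<^sup>2) summable_on UNIV"
  proof (rule summable_on_bounded_real)
    fix n
    have "0 \<le> weighted_degree X b (from_nat_into X n)"
      by (rule weighted_degree_nonneg[OF from_nat_into_mem])
    then have "0 \<le> weighted_degree X b (from_nat_into X n) + ?w n"
        "weighted_degree X b (from_nat_into X n) + ?w n \<le> 2 * ?w n"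
      by (auto simp: pendant_weight_def)
    then show "\<bar>weighted_degree (X <+> UNIV) (pendant_b X b) (Inl (from_nat_into X n)) *
        (u (Inl (from_nat_into X n)))\<^sup>2\<bar> \<le> 2 * ((u (Inl (from_nat_into X n)))\<^sup>2 * ?w n)"
      using mult_right_mono[of "weighted_degree X b (from_nat_into X n) + ?w n" "2 * ?w n"
          "(u (Inl (from_nat_into X n)))\<^sup>2"]
      by (simp add: weighted_degree_pendant(1) abs_mult mult_ac)
  qed
  then show "(\<lambda>x. weighted_degree (X <+> UNIV) (pendant_b X b) (Inl x) * (u (Inl x))\<^sup>2)
      summable_on X"
    \<comment> \<open>The enumeration reaches every vertex exactly once, so summability over indices
      is summability over X.\<close>
    using summable_on_reindex_bij_betw[OF bij_from_nat_into,
      of "\<lambda>x. weighted_degree (X <+> UNIV) (pendant_b X b) (Inl x) * (u (Inl x))\<^sup>2"] by simp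
qed

end

theorem theorem4p23:
  fixes X :: "'a set" and b :: "'a \<Rightarrow> 'a \<Rightarrow> real" and m :: "'a \<Rightarrow> real"
  assumes "weighted_graph X b m"
    and "condition_A X b m"
  shows "\<exists>(X' :: ('a + nat) set) b' m'.
           induced_supergraph (Inl ` X) (copy_b b) (copy_m m) X' b' m' \<and>
           condition_A X' b' m' \<and>
           essentially_self_adjoint X' m' (Lc X' b' m')"
proof -
  interpret weighted_graph X b m by fact
  interpret P: weighted_graph_A "X <+> UNIV" "pendant_b X b" "pendant_m X b m"
    using weighted_graph_pendant condition_A_pendant[OF assms(2)]
    by (simp add: weighted_graph_A_def weighted_graph_A_axioms_def)
  have "essentially_self_adjoint (X <+> UNIV) (pendant_m X b m)
      (Lc (X <+> UNIV) (pendant_b X b) (pendant_m X b m))"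
    by (rule P.essentially_self_adjoint_criterion) (rule pendant_degree_summable[OF assms(2)])
  with induced_supergraph_pendant condition_A_pendant[OF assms(2)] show ?thesis by blast
qed

end
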